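(* Let $G$ be a braided simplicial group. Then the loop simplicial group $\Omega G$ is braided. Thus any iterated loop simplicial groups of $G$ are braided.
   Context: Braided simplicial groups: a simplicial group $G=(G_n,d_j,s_j)$ is braided if for every $n$ there is an action by group automorphisms of the braid group $B_{n+1}$ on $G_n$, where the standard generators of $B_{n+1}$ are labelled $\sigma_{-1},\sigma_0,\dots,\sigma_{n-2}$, such that for all $n$, all $-1\le k\le n-2$ and $0\le j\le n$ the following hold on $G_n$ (composition right to left): $d_j\sigma_k=\sigma_{k-1}d_j$ if $j\le k$, $d_{k+1}\sigma_k=d_{k+2}$, $d_{k+2}\sigma_k=d_{k+1}$, $d_j\sigma_k=\sigma_kd_j$ if $j>k+2$; $s_j\sigma_k=\sigma_{k+1}s_j$ if $j\le k$, $s_{k+1}\sigma_k=\sigma_{k+1}\sigma_ks_{k+2}$, $s_{k+2}\sigma_k=\sigma_k\sigma_{k+1}s_{k+1}$, $s_j\sigma_k=\sigma_ks_j$ if $j>k+2$. Let $R_0G_q=\{x\in G_q\mid d_{i_1}d_{i_2}\cdots d_{i_q}(x)=1\text{ for all composites of } q \text{ faces } G_q\to G_0\}$. The loop simplicial group $\Omega G$ is defined by $\Omega G_n=\ker(d_0\colon G_{n+1}\to G_n)\cap R_0G_{n+1}$, whose $j$-th face is the restriction of $d_{j+1}$ of $G$ and whose $j$-th degeneracy is the restriction of $s_{j+1}$ of $G$. Iterated loop simplicial groups are obtained by iterating $\Omega$. *)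

theory Defs
  imports "HOL-Algebra.Coset" "HOL-Algebra.Bij"
begin

section \<open>Braid groups\<close>

text \<open>
  The braid group on \<open>m\<close> strands is given by its Artin presentation, with generators
  numbered \<open>1, \<dots>, m - 1\<close>. The letter \<open>(i, True)\<close> stands for the \<open>i\<close>-th generator and
  \<open>(i, False)\<close> for its inverse.
\<close>

type_synonym braid_word = "(nat \<times> bool) list"

definition braid_words :: "nat \<Rightarrow> braid_word set" where
  "braid_words m = lists ({1..<m} \<times> UNIV)"

inductive braid_cong :: "nat \<Rightarrow> braid_word \<Rightarrow> braid_word \<Rightarrow> bool" for m :: nat where
  refl: "w \<in> braid_words m \<Longrightarrow> braid_cong m w w"
| sym: "braid_cong m u v \<Longrightarrow> braid_cong m v u"
| trans: "braid_cong m u v \<Longrightarrow> braid_cong m v w \<Longrightarrow> braid_cong m u w"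
| append: "braid_cong m u v \<Longrightarrow> braid_cong m u' v' \<Longrightarrow> braid_cong m (u @ u') (v @ v')"
| cancel: "i \<in> {1..<m} \<Longrightarrow> braid_cong m [(i, b), (i, \<not> b)] []"
| far: "i \<in> {1..<m} \<Longrightarrow> j \<in> {1..<m} \<Longrightarrow> i + 2 \<le> j \<Longrightarrow>
    braid_cong m [(i, True), (j, True)] [(j, True), (i, True)]"
| braid: "i \<in> {1..<m} \<Longrightarrow> i + 1 \<in> {1..<m} \<Longrightarrow>
    braid_cong m [(i, True), (i + 1, True), (i, True)] [(i + 1, True), (i, True), (i + 1, True)]"

definition braid_rel :: "nat \<Rightarrow> (braid_word \<times> braid_word) set" where
  "braid_rel m = {(u, v). braid_cong m u v}"

definition braid_group :: "nat \<Rightarrow> braid_word set monoid" where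
  "braid_group m =
    \<lparr>carrier = braid_words m // braid_rel m,
     mult = \<lambda>A B. \<Union>u\<in>A. \<Union>v\<in>B. braid_rel m `` {u @ v},
     one = braid_rel m `` {[]}\<rparr>"

definition braid_gen :: "nat \<Rightarrow> nat \<Rightarrow> braid_word set" where
  "braid_gen m i = braid_rel m `` {[(i, True)]}"

lemma braid_cong_words: "braid_cong m u v \<Longrightarrow> u \<in> braid_words m \<and> v \<in> braid_words m"
  by (induction rule: braid_cong.induct) (auto simp: braid_words_def)

lemma equiv_braid_rel: "equiv (braid_words m) (braid_rel m)"
proof (rule equivI)
  show "braid_rel m \<subseteq> braid_words m \<times> braid_words m"
    by (auto simp: braid_rel_def dest: braid_cong_words)
  show "refl_on (braid_words m) (braid_rel m)"
    by (auto simp: refl_on_def braid_rel_def intro: braid_cong.refl)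
  show "sym (braid_rel m)"
    by (auto simp: sym_def braid_rel_def intro: braid_cong.sym)
  show "trans (braid_rel m)"
    by (auto simp: trans_def braid_rel_def intro: braid_cong.trans)
qed

lemma braid_mult_class:
  assumes "u \<in> braid_words m" "v \<in> braid_words m"
  shows "(braid_rel m `` {u}) \<otimes>\<^bsub>braid_group m\<^esub> (braid_rel m `` {v}) = braid_rel m `` {u @ v}"
proof -
  have "braid_rel m `` {u' @ v'} = braid_rel m `` {u @ v}"
    if "u' \<in> braid_rel m `` {u}" "v' \<in> braid_rel m `` {v}" for u' v'
  proof -
    have "braid_cong m (u @ v) (u' @ v')"
      using that by (auto simp: braid_rel_def intro: braid_cong.append)
    then have "(u @ v, u' @ v') \<in> braid_rel m"
      by (simp add: braid_rel_def)
    then show ?thesis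
      by (rule equiv_class_eq [OF equiv_braid_rel, symmetric])
  qed
  moreover have "u \<in> braid_rel m `` {u}" "v \<in> braid_rel m `` {v}"
    using assms by (auto simp: braid_rel_def intro: braid_cong.refl)
  ultimately have "(\<Union>u'\<in>braid_rel m `` {u}. \<Union>v'\<in>braid_rel m `` {v}. braid_rel m `` {u' @ v'})
      = braid_rel m `` {u @ v}"
    by fast
  then show ?thesis
    by (simp add: braid_group_def)
qed

lemma braid_word_inverse:
  assumes "w \<in> braid_words m"
  shows "\<exists>v\<in>braid_words m. braid_cong m (v @ w) []"
  using assms
proof (induction w)
  case Nil
  then show ?case
    by (intro bexI [of _ "[]"]) (auto simp: braid_words_def intro: braid_cong.refl)
next
  case (Cons a w)
  obtain i b where a: "a = (i, b)"
    by (cases a)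
  have i: "i \<in> {1..<m}" and w: "w \<in> braid_words m"
    using Cons.prems by (auto simp: a braid_words_def)
  obtain v where v: "v \<in> braid_words m" "braid_cong m (v @ w) []"
    using Cons.IH [OF w] by blast
  have "braid_cong m ([(i, \<not> b), (i, \<not> \<not> b)] @ w) ([] @ w)"
    by (intro braid_cong.append braid_cong.cancel braid_cong.refl i w)
  then have "braid_cong m (v @ ([(i, \<not> b), (i, b)] @ w)) (v @ w)"
    using braid_cong.append [OF braid_cong.refl [OF v(1)]] by simp
  then have "braid_cong m ((v @ [(i, \<not> b)]) @ (a # w)) []"
    using braid_cong.trans [OF _ v(2)] by (simp add: a)
  moreover have "v @ [(i, \<not> b)] \<in> braid_words m"
    using v(1) i by (auto simp: braid_words_def)
  ultimately show ?case
    by blast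
qed

lemma group_braid_group: "group (braid_group m)"
proof (rule groupI)
  have carr: "\<exists>u\<in>braid_words m. x = braid_rel m `` {u}"
    if "x \<in> carrier (braid_group m)" for x
    using that by (auto simp: braid_group_def elim: quotientE)
  have cl: "braid_rel m `` {u} \<in> carrier (braid_group m)" if "u \<in> braid_words m" for u
    using that by (auto simp: braid_group_def intro: quotientI)
  have app: "u @ v \<in> braid_words m" if "u \<in> braid_words m" "v \<in> braid_words m" for u v
    using that by (auto simp: braid_words_def)
  have nil: "[] \<in> braid_words m"
    by (simp add: braid_words_def)
  have one: "\<one>\<^bsub>braid_group m\<^esub> = braid_rel m `` {[]}"
    by (simp add: braid_group_def)
  show "\<one>\<^bsub>braid_group m\<^esub> \<in> carrier (braid_group m)"
    by (simp add: one cl nil)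
  show "x \<otimes>\<^bsub>braid_group m\<^esub> y \<in> carrier (braid_group m)"
    if "x \<in> carrier (braid_group m)" "y \<in> carrier (braid_group m)" for x y
    using carr [OF that(1)] carr [OF that(2)] by (auto simp: braid_mult_class cl app)
  show "x \<otimes>\<^bsub>braid_group m\<^esub> y \<otimes>\<^bsub>braid_group m\<^esub> z = x \<otimes>\<^bsub>braid_group m\<^esub> (y \<otimes>\<^bsub>braid_group m\<^esub> z)"
    if "x \<in> carrier (braid_group m)" "y \<in> carrier (braid_group m)" "z \<in> carrier (braid_group m)"
    for x y z
    using carr [OF that(1)] carr [OF that(2)] carr [OF that(3)]
    by (auto simp: braid_mult_class app)
  show "\<one>\<^bsub>braid_group m\<^esub> \<otimes>\<^bsub>braid_group m\<^esub> x = x" if "x \<in> carrier (braid_group m)" for x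
    using carr [OF that] by (auto simp: one braid_mult_class nil)
  show "\<exists>y\<in>carrier (braid_group m). y \<otimes>\<^bsub>braid_group m\<^esub> x = \<one>\<^bsub>braid_group m\<^esub>"
    if "x \<in> carrier (braid_group m)" for x
  proof -
    obtain u where u: "u \<in> braid_words m" "x = braid_rel m `` {u}"
      using carr [OF \<open>x \<in> _\<close>] by blast
    obtain v where v: "v \<in> braid_words m" "braid_cong m (v @ u) []"
      using braid_word_inverse [OF u(1)] by blast
    have "braid_rel m `` {v @ u} = braid_rel m `` {[]}"
      using v(2) by (intro equiv_class_eq [OF equiv_braid_rel]) (simp add: braid_rel_def)
    then show ?thesis
      using u v by (intro bexI [of _ "braid_rel m `` {v}"]) (auto simp: one braid_mult_class cl)
  qed
qed

section \<open>Simplicial groups\<close>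

text \<open>
  \<open>face X n j\<close> and \<open>degen X n j\<close> are the maps \<open>d\<^sub>j\<close> and \<open>s\<^sub>j\<close> defined on the group in degree
  \<open>n\<close>; they are meaningful for \<open>j \<le> n\<close> only (and \<open>n > 0\<close> for faces), and on the carrier only.
\<close>

record 'a simplicial_data =
  level :: "nat \<Rightarrow> 'a monoid"
  face :: "nat \<Rightarrow> nat \<Rightarrow> 'a \<Rightarrow> 'a"
  degen :: "nat \<Rightarrow> nat \<Rightarrow> 'a \<Rightarrow> 'a"

locale simplicial_group =
  fixes X :: "'a simplicial_data"
  assumes group_level: "group (level X n)"
    and face_hom: "j \<le> Suc n \<Longrightarrow> face X (Suc n) j \<in> hom (level X (Suc n)) (level X n)"
    and degen_hom: "j \<le> n \<Longrightarrow> degen X n j \<in> hom (level X n) (level X (Suc n))"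
    and face_face: "i < j \<Longrightarrow> j \<le> Suc (Suc n) \<Longrightarrow> x \<in> carrier (level X (Suc (Suc n))) \<Longrightarrow>
      face X (Suc n) i (face X (Suc (Suc n)) j x)
        = face X (Suc n) (j - 1) (face X (Suc (Suc n)) i x)"
    and degen_degen: "i \<le> j \<Longrightarrow> j \<le> n \<Longrightarrow> x \<in> carrier (level X n) \<Longrightarrow>
      degen X (Suc n) i (degen X n j x) = degen X (Suc n) (j + 1) (degen X n i x)"
    and face_degen_less: "i < j \<Longrightarrow> j \<le> n \<Longrightarrow> x \<in> carrier (level X n) \<Longrightarrow>
      face X (Suc n) i (degen X n j x) = degen X (n - 1) (j - 1) (face X n i x)"
    and face_degen_id: "i = j \<or> i = j + 1 \<Longrightarrow> j \<le> n \<Longrightarrow> x \<in> carrier (level X n) \<Longrightarrow>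
      face X (Suc n) i (degen X n j x) = x"
    and face_degen_greater: "j + 1 < i \<Longrightarrow> i \<le> Suc n \<Longrightarrow> x \<in> carrier (level X n) \<Longrightarrow>
      face X (Suc n) i (degen X n j x) = degen X (n - 1) j (face X n (i - 1) x)"

section \<open>Braided simplicial groups\<close>

text \<open>
  The standard generators of the braid group on \<open>n + 1\<close> strands, which acts in degree \<open>n\<close>, are
  labelled \<open>- 1, \<dots>, n - 2\<close>; hence label \<open>k\<close> is generator number \<open>k + 2\<close>. Below, \<open>\<phi> n\<close> is the
  action in degree \<open>n\<close>, given as a homomorphism into the automorphism group, whose
  multiplication is composition from right to left.
\<close>

definition braid_sigma ::
    "(nat \<Rightarrow> braid_word set \<Rightarrow> 'a \<Rightarrow> 'a) \<Rightarrow> nat \<Rightarrow> int \<Rightarrow> 'a \<Rightarrow> 'a" where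
  "braid_sigma \<phi> n k = \<phi> n (braid_gen (n + 1) (nat (k + 2)))"

locale braiding = simplicial_group X
  for X :: "'a simplicial_data" +
  fixes \<phi> :: "nat \<Rightarrow> braid_word set \<Rightarrow> 'a \<Rightarrow> 'a"
  assumes action: "\<phi> n \<in> hom (braid_group (n + 1)) (AutoGroup (level X n))"
    and face_sigma_le:
      "- 1 \<le> k \<Longrightarrow> k \<le> int n - 2 \<Longrightarrow> j \<le> n \<Longrightarrow> int j \<le> k \<Longrightarrow> x \<in> carrier (level X n) \<Longrightarrow>
        face X n j (braid_sigma \<phi> n k x) = braid_sigma \<phi> (n - 1) (k - 1) (face X n j x)"
    and face_sigma_1:
      "- 1 \<le> k \<Longrightarrow> k \<le> int n - 2 \<Longrightarrow> x \<in> carrier (level X n) \<Longrightarrow>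
        face X n (nat (k + 1)) (braid_sigma \<phi> n k x) = face X n (nat (k + 2)) x"
    and face_sigma_2:
      "- 1 \<le> k \<Longrightarrow> k \<le> int n - 2 \<Longrightarrow> x \<in> carrier (level X n) \<Longrightarrow>
        face X n (nat (k + 2)) (braid_sigma \<phi> n k x) = face X n (nat (k + 1)) x"
    and face_sigma_greater:
      "- 1 \<le> k \<Longrightarrow> k \<le> int n - 2 \<Longrightarrow> j \<le> n \<Longrightarrow> int j > k + 2 \<Longrightarrow> x \<in> carrier (level X n) \<Longrightarrow>
        face X n j (braid_sigma \<phi> n k x) = braid_sigma \<phi> (n - 1) k (face X n j x)"
    and degen_sigma_le:
      "- 1 \<le> k \<Longrightarrow> k \<le> int n - 2 \<Longrightarrow> j \<le> n \<Longrightarrow> int j \<le> k \<Longrightarrow> x \<in> carrier (level X n) \<Longrightarrow>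
        degen X n j (braid_sigma \<phi> n k x) = braid_sigma \<phi> (n + 1) (k + 1) (degen X n j x)"
    and degen_sigma_1:
      "- 1 \<le> k \<Longrightarrow> k \<le> int n - 2 \<Longrightarrow> x \<in> carrier (level X n) \<Longrightarrow>
        degen X n (nat (k + 1)) (braid_sigma \<phi> n k x)
          = braid_sigma \<phi> (n + 1) (k + 1) (braid_sigma \<phi> (n + 1) k (degen X n (nat (k + 2)) x))"
    and degen_sigma_2:
      "- 1 \<le> k \<Longrightarrow> k \<le> int n - 2 \<Longrightarrow> x \<in> carrier (level X n) \<Longrightarrow>
        degen X n (nat (k + 2)) (braid_sigma \<phi> n k x)
          = braid_sigma \<phi> (n + 1) k (braid_sigma \<phi> (n + 1) (k + 1) (degen X n (nat (k + 1)) x))"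
    and degen_sigma_greater:
      "- 1 \<le> k \<Longrightarrow> k \<le> int n - 2 \<Longrightarrow> j \<le> n \<Longrightarrow> int j > k + 2 \<Longrightarrow> x \<in> carrier (level X n) \<Longrightarrow>
        degen X n j (braid_sigma \<phi> n k x) = braid_sigma \<phi> (n + 1) k (degen X n j x)"

definition braided_simplicial_group :: "'a simplicial_data \<Rightarrow> bool" where
  "braided_simplicial_group X \<longleftrightarrow> (\<exists>\<phi>. braiding X \<phi>)"

section \<open>The loop simplicial group\<close>

primrec face_composites :: "'a simplicial_data \<Rightarrow> nat \<Rightarrow> ('a \<Rightarrow> 'a) set" where
  "face_composites X 0 = {id}"
| "face_composites X (Suc q) =
    {f \<circ> face X (Suc q) j | f j. f \<in> face_composites X q \<and> j \<le> Suc q}"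

definition R0 :: "'a simplicial_data \<Rightarrow> nat \<Rightarrow> 'a set" where
  "R0 X q = {x \<in> carrier (level X q). \<forall>f\<in>face_composites X q. f x = \<one>\<^bsub>level X 0\<^esub>}"

definition loop :: "'a simplicial_data \<Rightarrow> 'a simplicial_data" where
  "loop X =
    \<lparr>level = \<lambda>n. (level X (Suc n))
       \<lparr>carrier := kernel (level X (Suc n)) (level X n) (face X (Suc n) 0) \<inter> R0 X (Suc n)\<rparr>,
     face = \<lambda>n j. face X (Suc n) (j + 1),
     degen = \<lambda>n j. degen X (Suc n) (j + 1)\<rparr>"

end

theory Submission
  imports Defs
begin

text \<open>
  The braiding of the loop simplicial group is the given one moved up by one index: \<open>\<sigma>\<^sub>k\<close> acts on
  \<open>\<Omega>G\<^sub>n \<subseteq> G\<^sub>n\<^sub>+\<^sub>1\<close> as \<open>\<sigma>\<^sub>k\<^sub>+\<^sub>1\<close>. The faces and degeneracies of \<open>\<Omega>G\<close> are moved up by one index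
  too, and the braiding identities depend only on the position of a face or degeneracy relative to a
  generator, so they hold in \<open>\<Omega>G\<close> because they hold in \<open>G\<close>.

  What needs an argument is that the shifted generators preserve \<open>\<Omega>G\<^sub>n\<close>. They preserve the kernel of
  \<open>d\<^sub>0\<close> because \<open>d\<^sub>0 \<sigma>\<^sub>k\<^sub>+\<^sub>1 = \<sigma>\<^sub>k d\<^sub>0\<close> as soon as \<open>k + 1 \<ge> 0\<close>; the shift serves to
  leave out \<open>\<sigma>\<^sub>-\<^sub>1\<close>, which would turn \<open>d\<^sub>0\<close> into \<open>d\<^sub>1\<close>. They preserve \<open>R\<^sub>0G\<close> because, up to generators acting
  in lower degree, \<open>\<sigma>\<^sub>k\<close> merely exchanges the faces \<open>d\<^sub>k\<^sub>+\<^sub>1\<close> and \<open>d\<^sub>k\<^sub>+\<^sub>2\<close>, so that an induction on the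
  degree applies (\<open>sigma_mem_R0_iff\<close>). Both arguments show that membership of \<open>x\<close> is
  \<^emph>\<open>equivalent\<close> to membership of \<open>\<sigma> x\<close>; hence the group elements with this
  property form a subgroup (\<open>stabilizer_subgroup\<close>), which is everything since it contains the generators,
  and the action restricts to automorphisms of \<open>\<Omega>G\<^sub>n\<close> (\<open>restrict_action\<close>).
\<close>

section \<open>Braid groups: generation and the index shift\<close>

lemma braid_class_in_carrier:
  "u \<in> braid_words m \<Longrightarrow> braid_rel m `` {u} \<in> carrier (braid_group m)"
  by (auto simp: braid_group_def intro: quotientI)

lemma braid_group_carrierE:
  assumes "b \<in> carrier (braid_group m)"
  obtains u where "u \<in> braid_words m" "b = braid_rel m `` {u}"
  using assms by (auto simp: braid_group_def elim: quotientE)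

lemma one_braid_group: "\<one>\<^bsub>braid_group m\<^esub> = braid_rel m `` {[]}"
  by (simp add: braid_group_def)

lemma braid_class_eq: "braid_cong m u v \<Longrightarrow> braid_rel m `` {u} = braid_rel m `` {v}"
  by (intro equiv_class_eq [OF equiv_braid_rel]) (simp add: braid_rel_def)

lemma braid_gen_in_carrier: "i \<in> {1..<m} \<Longrightarrow> braid_gen m i \<in> carrier (braid_group m)"
  unfolding braid_gen_def by (intro braid_class_in_carrier) (simp add: braid_words_def)

lemma inv_braid_gen:
  assumes "i \<in> {1..<m}"
  shows "inv\<^bsub>braid_group m\<^esub> (braid_gen m i) = braid_rel m `` {[(i, False)]}"
proof -
  interpret B: group "braid_group m" by (rule group_braid_group)
  have w: "[(i, b)] \<in> braid_words m" for b
    using assms by (simp add: braid_words_def)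
  have "braid_rel m `` {[(i, False)]} \<otimes>\<^bsub>braid_group m\<^esub> braid_gen m i = \<one>\<^bsub>braid_group m\<^esub>"
    using braid_class_eq [OF braid_cong.cancel [OF assms, of False]]
    by (simp add: braid_gen_def braid_mult_class w one_braid_group)
  then show ?thesis
    using B.inv_equality braid_class_in_carrier [OF w] braid_gen_in_carrier [OF assms] by blast
qed

lemma braid_group_generated:
  assumes S: "subgroup S (braid_group m)"
    and gens: "\<And>i. i \<in> {1..<m} \<Longrightarrow> braid_gen m i \<in> S"
  shows "carrier (braid_group m) \<subseteq> S"
proof
  fix b assume "b \<in> carrier (braid_group m)"
  then obtain u where u: "u \<in> braid_words m" "b = braid_rel m `` {u}"
    by (rule braid_group_carrierE)
  have "braid_rel m `` {u} \<in> S"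
    using u(1)
  proof (induction u)
    case Nil
    then show ?case
      using subgroup.one_closed [OF S] by (simp add: one_braid_group)
  next
    case (Cons a u)
    obtain i e where a: "a = (i, e)" by (cases a)
    have i: "i \<in> {1..<m}" and u: "u \<in> braid_words m"
      using Cons.prems by (auto simp: a braid_words_def)
    have "braid_rel m `` {[a]} \<in> S"
      using gens [OF i] subgroup.m_inv_closed [OF S gens [OF i]] inv_braid_gen [OF i]
      by (cases e) (auto simp: a braid_gen_def)
    then have "braid_rel m `` {[a]} \<otimes>\<^bsub>braid_group m\<^esub> braid_rel m `` {u} \<in> S"
      using Cons.IH [OF u] by (rule subgroup.m_closed [OF S])
    moreover have "[a] \<in> braid_words m"
      using i by (simp add: a braid_words_def)
    ultimately show ?case
      by (simp add: braid_mult_class u)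
  qed
  then show "b \<in> S" by (simp add: u(2))
qed

definition shift_word :: "braid_word \<Rightarrow> braid_word" where
  "shift_word = map (map_prod Suc id)"

text \<open>
  This is the homomorphism from the braid group on \<open>m\<close> strands to that on \<open>m + 1\<close> strands which adds
  a first strand that stays straight.
\<close>

definition braid_shift :: "nat \<Rightarrow> braid_word set \<Rightarrow> braid_word set" where
  "braid_shift m A = (\<Union>u\<in>A. braid_rel (Suc m) `` {shift_word u})"

lemma shift_word_in: "u \<in> braid_words m \<Longrightarrow> shift_word u \<in> braid_words (Suc m)"
  by (fastforce simp: shift_word_def braid_words_def in_lists_conv_set)

lemma braid_cong_shift: "braid_cong m u v \<Longrightarrow> braid_cong (Suc m) (shift_word u) (shift_word v)"
proof (induction rule: braid_cong.induct)
  case (refl w)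
  then show ?case by (intro braid_cong.refl shift_word_in)
next
  case (trans u v w)
  then show ?case by (blast intro: braid_cong.trans)
next
  case (append u v u' v')
  then show ?case
    using braid_cong.append by (fastforce simp: shift_word_def)
next
  case (cancel i b)
  then show ?case
    using braid_cong.cancel [of "Suc i" "Suc m" b] by (simp add: shift_word_def)
next
  case (far i j)
  then show ?case
    using braid_cong.far [of "Suc i" "Suc m" "Suc j"] by (simp add: shift_word_def)
next
  case (braid i)
  then show ?case
    using braid_cong.braid [of "Suc i" "Suc m"] by (simp add: shift_word_def)
qed (rule braid_cong.sym)

lemma braid_shift_class:
  assumes "u \<in> braid_words m"
  shows "braid_shift m (braid_rel m `` {u}) = braid_rel (Suc m) `` {shift_word u}"
proof -
  have "braid_rel (Suc m) `` {shift_word v} = braid_rel (Suc m) `` {shift_word u}"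
    if "v \<in> braid_rel m `` {u}" for v
    using that braid_class_eq [OF braid_cong_shift] by (auto simp: braid_rel_def)
  moreover have "u \<in> braid_rel m `` {u}"
    using assms by (auto simp: braid_rel_def intro: braid_cong.refl)
  ultimately show ?thesis
    unfolding braid_shift_def by fast
qed

lemma braid_shift_hom: "braid_shift m \<in> hom (braid_group m) (braid_group (Suc m))"
proof (rule homI)
  fix a b assume a: "a \<in> carrier (braid_group m)" and b: "b \<in> carrier (braid_group m)"
  obtain u where u: "u \<in> braid_words m" "a = braid_rel m `` {u}"
    using a by (rule braid_group_carrierE)
  obtain v where v: "v \<in> braid_words m" "b = braid_rel m `` {v}"
    using b by (rule braid_group_carrierE)
  have "u @ v \<in> braid_words m"
    using u v by (simp add: braid_words_def)
  then show "braid_shift m (a \<otimes>\<^bsub>braid_group m\<^esub> b)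
      = braid_shift m a \<otimes>\<^bsub>braid_group (Suc m)\<^esub> braid_shift m b"
    using u v by (simp add: braid_mult_class braid_shift_class shift_word_in)
      (simp add: shift_word_def)
  show "braid_shift m a \<in> carrier (braid_group (Suc m))"
    using u by (simp add: braid_shift_class shift_word_in braid_class_in_carrier)
qed

lemma braid_shift_gen:
  "i \<in> {1..<m} \<Longrightarrow> braid_shift m (braid_gen m i) = braid_gen (Suc m) (Suc i)"
  unfolding braid_gen_def
  by (subst braid_shift_class) (simp_all add: braid_words_def shift_word_def)

section \<open>Group actions by automorphisms\<close>

lemma action_bij:
  assumes "\<alpha> \<in> hom B (AutoGroup K)" "b \<in> carrier B"
  shows "bij_betw (\<alpha> b) (carrier K) (carrier K)"
  using hom_in_carrier [OF assms] by (simp add: AutoGroup_def auto_def Bij_def)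

lemma action_in_hom:
  assumes "\<alpha> \<in> hom B (AutoGroup K)" "b \<in> carrier B"
  shows "\<alpha> b \<in> hom K K"
  using hom_in_carrier [OF assms] by (simp add: AutoGroup_def auto_def)

lemma action_mult:
  assumes "\<alpha> \<in> hom B (AutoGroup K)" "a \<in> carrier B" "b \<in> carrier B" "x \<in> carrier K"
  shows "\<alpha> (a \<otimes>\<^bsub>B\<^esub> b) x = \<alpha> a (\<alpha> b x)"
  using hom_mult [OF assms(1-3)] hom_in_carrier [OF assms(1,2)] hom_in_carrier [OF assms(1,3)]
    assms(4)
  by (simp add: AutoGroup_def auto_def BijGroup_def compose_def)

lemma action_one:
  assumes "group B" "\<alpha> \<in> hom B (AutoGroup K)" "x \<in> carrier K"
  shows "\<alpha> \<one>\<^bsub>B\<^esub> x = x"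
proof -
  interpret B: group B by fact
  have bij: "bij_betw (\<alpha> \<one>\<^bsub>B\<^esub>) (carrier K) (carrier K)"
    using assms by (simp add: action_bij)
  have "\<alpha> \<one>\<^bsub>B\<^esub> (\<alpha> \<one>\<^bsub>B\<^esub> x) = \<alpha> \<one>\<^bsub>B\<^esub> x"
    using action_mult [OF assms(2) B.one_closed B.one_closed assms(3)] by simp
  then show ?thesis
    using bij assms(3) by (meson bij_betwE bij_betw_imp_inj_on inj_onD)
qed

text \<open>
  Asking for an equivalence, rather than for \<open>H\<close> to be mapped into itself, is what makes the set
  closed under inverses when \<open>H\<close> is infinite.
\<close>

lemma stabilizer_subgroup:
  assumes "group B" and \<alpha>: "\<alpha> \<in> hom B (AutoGroup K)"
  shows "subgroup {b \<in> carrier B. \<forall>x\<in>carrier K. \<alpha> b x \<in> H \<longleftrightarrow> x \<in> H} B" (is "subgroup ?S B")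
proof -
  interpret B: group B by fact
  have cl: "\<alpha> b x \<in> carrier K" if "b \<in> carrier B" "x \<in> carrier K" for b x
    using action_bij [OF \<alpha> that(1)] that(2) by (meson bij_betwE)
  show ?thesis
  proof (rule B.subgroupI)
    show "?S \<noteq> {}"
      using action_one [OF assms] by auto
  next
    fix b assume b: "b \<in> ?S"
    have "\<alpha> (inv\<^bsub>B\<^esub> b) x \<in> H \<longleftrightarrow> x \<in> H" if x: "x \<in> carrier K" for x
    proof -
      have "\<alpha> b (\<alpha> (inv\<^bsub>B\<^esub> b) x) = x"
        using b x action_mult [OF \<alpha>, of b "inv\<^bsub>B\<^esub> b" x] action_one [OF assms x] by simp
      moreover have "\<alpha> b (\<alpha> (inv\<^bsub>B\<^esub> b) x) \<in> H \<longleftrightarrow> \<alpha> (inv\<^bsub>B\<^esub> b) x \<in> H"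
        using b x cl by simp
      ultimately show ?thesis by simp
    qed
    then show "inv\<^bsub>B\<^esub> b \<in> ?S" using b by simp
  next
    fix a b assume "a \<in> ?S" "b \<in> ?S"
    then show "a \<otimes>\<^bsub>B\<^esub> b \<in> ?S"
      using action_mult [OF \<alpha>] cl by simp
  qed auto
qed

lemma restrict_action:
  assumes B: "group B" and \<alpha>: "\<alpha> \<in> hom B (AutoGroup K)" and H: "H \<subseteq> carrier K"
    and closed: "\<And>x y. x \<in> H \<Longrightarrow> y \<in> H \<Longrightarrow> x \<otimes>\<^bsub>K\<^esub> y \<in> H"
    and stable: "\<And>b x. b \<in> carrier B \<Longrightarrow> x \<in> carrier K \<Longrightarrow> \<alpha> b x \<in> H \<longleftrightarrow> x \<in> H"
  shows "(\<lambda>b. restrict (\<alpha> b) H) \<in> hom B (AutoGroup (K\<lparr>carrier := H\<rparr>))"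
proof -
  have Bij: "restrict (\<alpha> b) H \<in> Bij H" if b: "b \<in> carrier B" for b
  proof -
    have bij: "bij_betw (\<alpha> b) (carrier K) (carrier K)"
      by (rule action_bij [OF \<alpha> b])
    have "\<alpha> b ` H = H"
    proof
      show "\<alpha> b ` H \<subseteq> H" using stable [OF b] H by auto
      show "H \<subseteq> \<alpha> b ` H"
      proof
        fix y assume y: "y \<in> H"
        then obtain x where x: "x \<in> carrier K" "y = \<alpha> b x"
          using bij H unfolding bij_betw_def by blast
        then show "y \<in> \<alpha> b ` H" using y stable [OF b] by blast
      qed
    qed
    moreover have "inj_on (\<alpha> b) H"
      using bij H by (meson bij_betw_imp_inj_on inj_on_subset)
    ultimately show ?thesis
      by (simp add: Bij_def bij_betw_def inj_on_restrict_eq)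
  qed
  have auto: "restrict (\<alpha> b) H \<in> auto (K\<lparr>carrier := H\<rparr>)" if b: "b \<in> carrier B" for b
    using Bij [OF b] hom_mult [OF action_in_hom [OF \<alpha> b]] H closed stable [OF b]
    by (auto simp: auto_def hom_def subset_iff)
  have restrict_stable: "\<alpha> b x \<in> H" if "b \<in> carrier B" "x \<in> H" for b x
    using that stable H by blast
  show ?thesis
  proof (rule homI)
    fix a b assume a: "a \<in> carrier B" and b: "b \<in> carrier B"
    have "restrict (\<alpha> (a \<otimes>\<^bsub>B\<^esub> b)) H = compose H (restrict (\<alpha> a) H) (restrict (\<alpha> b) H)"
      using action_mult [OF \<alpha> a b] restrict_stable [OF b] H
      by (auto simp: compose_def fun_eq_iff)
    then show "restrict (\<alpha> (a \<otimes>\<^bsub>B\<^esub> b)) H =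
        restrict (\<alpha> a) H \<otimes>\<^bsub>AutoGroup (K\<lparr>carrier := H\<rparr>)\<^esub> restrict (\<alpha> b) H"
      using Bij [OF a] Bij [OF b] by (simp add: AutoGroup_def BijGroup_def)
  qed (use auto in \<open>simp add: AutoGroup_def\<close>)
qed

section \<open>The loop simplicial group\<close>

lemma R0_carrier: "x \<in> R0 X q \<Longrightarrow> x \<in> carrier (level X q)"
  by (simp add: R0_def)

lemma R0_D: "x \<in> R0 X q \<Longrightarrow> f \<in> face_composites X q \<Longrightarrow> f x = \<one>\<^bsub>level X 0\<^esub>"
  by (simp add: R0_def)

lemma R0_Suc:
  assumes "simplicial_group X"
  shows "x \<in> R0 X (Suc q) \<longleftrightarrow>
    x \<in> carrier (level X (Suc q)) \<and> (\<forall>j\<le>Suc q. face X (Suc q) j x \<in> R0 X q)"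
proof -
  have "face X (Suc q) j x \<in> carrier (level X q)"
    if "j \<le> Suc q" "x \<in> carrier (level X (Suc q))" for j
    using hom_in_carrier [OF simplicial_group.face_hom [OF assms that(1)] that(2)] .
  then show ?thesis
    by (fastforce simp: R0_def)
qed

lemma face_composites_hom:
  assumes "simplicial_group X" "f \<in> face_composites X q"
  shows "f \<in> hom (level X q) (level X 0)"
  using assms(2)
proof (induction q arbitrary: f)
  case 0
  then show ?case by (simp add: hom_def)
next
  case (Suc q)
  then show ?case
    using simplicial_group.face_hom [OF assms(1)] by (auto intro: hom_compose)
qed

lemma R0_subgroup:
  assumes "simplicial_group X"
  shows "subgroup (R0 X q) (level X q)"
proof -
  interpret simplicial_group X by fact
  interpret K: group "level X q" by (rule group_level)
  interpret K0: group "level X 0" by (rule group_level)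
  have f: "group_hom (level X q) (level X 0) f" if "f \<in> face_composites X q" for f
    using face_composites_hom [OF assms that] K.is_group K0.is_group
    by (simp add: group_hom_def group_hom_axioms_def)
  show ?thesis
  proof (rule K.subgroupI)
    show "R0 X q \<noteq> {}"
      using f group_hom.hom_one unfolding R0_def by blast
    fix a assume a: "a \<in> R0 X q"
    have "g (inv\<^bsub>level X q\<^esub> a) = \<one>\<^bsub>level X 0\<^esub>" if g: "g \<in> face_composites X q" for g
      using group_hom.hom_inv [OF f [OF g] R0_carrier [OF a]] by (simp add: R0_D [OF a g])
    then show "inv\<^bsub>level X q\<^esub> a \<in> R0 X q"
      using R0_carrier [OF a] unfolding R0_def by blast
  next
    fix a b assume a: "a \<in> R0 X q" and b: "b \<in> R0 X q"
    have "g (a \<otimes>\<^bsub>level X q\<^esub> b) = \<one>\<^bsub>level X 0\<^esub>" if g: "g \<in> face_composites X q" for g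
      using group_hom.hom_mult [OF f [OF g] R0_carrier [OF a] R0_carrier [OF b]]
      by (simp add: R0_D [OF a g] R0_D [OF b g])
    then show "a \<otimes>\<^bsub>level X q\<^esub> b \<in> R0 X q"
      using R0_carrier [OF a] R0_carrier [OF b] unfolding R0_def by blast
  qed (auto simp: R0_def)
qed

text \<open>
  Only the carrier of a level changes in the loop group; in this form, results on subgroups and
  restricted actions apply to it.
\<close>

lemma level_loop:
  "level (loop X) n = (level X (Suc n))\<lparr>carrier := carrier (level (loop X) n)\<rparr>"
  by (simp add: loop_def)

lemma mult_level_loop [simp]: "x \<otimes>\<^bsub>level (loop X) n\<^esub> y = x \<otimes>\<^bsub>level X (Suc n)\<^esub> y"
  by (simp add: loop_def)

lemma face_loop [simp]: "face (loop X) n j = face X (Suc n) (Suc j)"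
  by (simp add: loop_def)

lemma degen_loop [simp]: "degen (loop X) n j = degen X (Suc n) (Suc j)"
  by (simp add: loop_def)

lemma mem_carrier_loop:
  "x \<in> carrier (level (loop X) n) \<longleftrightarrow>
    x \<in> carrier (level X (Suc n)) \<and> face X (Suc n) 0 x = \<one>\<^bsub>level X n\<^esub> \<and> x \<in> R0 X (Suc n)"
  by (auto simp: loop_def kernel_def)

lemma loop_carrierD: "x \<in> carrier (level (loop X) n) \<Longrightarrow> x \<in> carrier (level X (Suc n))"
  by (simp add: mem_carrier_loop)

context simplicial_group
begin

lemma face_closed:
  "j \<le> Suc n \<Longrightarrow> x \<in> carrier (level X (Suc n)) \<Longrightarrow> face X (Suc n) j x \<in> carrier (level X n)"
  using face_hom hom_in_carrier by metis

lemma degen_closed: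
  "j \<le> n \<Longrightarrow> x \<in> carrier (level X n) \<Longrightarrow> degen X n j x \<in> carrier (level X (Suc n))"
  using degen_hom hom_in_carrier by metis

lemma face_one: "j \<le> Suc n \<Longrightarrow> face X (Suc n) j \<one>\<^bsub>level X (Suc n)\<^esub> = \<one>\<^bsub>level X n\<^esub>"
  using face_hom group_level hom_one by metis

lemma degen_one: "j \<le> n \<Longrightarrow> degen X n j \<one>\<^bsub>level X n\<^esub> = \<one>\<^bsub>level X (Suc n)\<^esub>"
  using degen_hom group_level hom_one by metis

text \<open>A face of a degenerate element is the element itself or a degeneracy of one of its faces,
  so the claim in one degree reduces to the claim in the degree below.\<close>

lemma degen_R0: "x \<in> R0 X q \<Longrightarrow> j \<le> q \<Longrightarrow> degen X q j x \<in> R0 X (Suc q)"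
proof (induction q arbitrary: x j)
  case 0
  then have x: "x \<in> carrier (level X 0)" by (simp add: R0_carrier)
  have "face X (Suc 0) i (degen X 0 0 x) \<in> R0 X 0" if "i \<le> Suc 0" for i
  proof -
    have "face X (Suc 0) i (degen X 0 0 x) = x"
      using face_degen_id [of i 0 0 x] that x by linarith
    then show ?thesis using 0(1) by (simp only:)
  qed
  then show ?case
    using 0(2) x degen_closed [of 0 0 x] by (simp add: R0_Suc [OF simplicial_group_axioms])
next
  case (Suc q)
  have x: "x \<in> carrier (level X (Suc q))"
    and dx: "\<And>i. i \<le> Suc q \<Longrightarrow> face X (Suc q) i x \<in> R0 X q"
    using Suc.prems(1) by (simp_all add: R0_Suc [OF simplicial_group_axioms])
  have "face X (Suc (Suc q)) i (degen X (Suc q) j x) \<in> R0 X (Suc q)" if i: "i \<le> Suc (Suc q)" for i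
  proof -
    consider "i < j" | "i = j \<or> i = j + 1" | "j + 1 < i" by linarith
    then show ?thesis
    proof cases
      case 1
      then show ?thesis
        using face_degen_less [OF 1 Suc.prems(2) x] Suc.IH [OF dx [of i], of "j - 1"] Suc.prems(2)
        by simp
    next
      case 2
      then show ?thesis
        using face_degen_id [OF 2 Suc.prems(2) x] Suc.prems(1) by simp
    next
      case 3
      then show ?thesis
        using face_degen_greater [OF 3 i x] Suc.IH [OF dx [of "i - 1"], of j] i by simp
    qed
  qed
  then show ?case
    using degen_closed [OF Suc.prems(2) x] by (subst R0_Suc [OF simplicial_group_axioms]) simp
qed

lemma loop_carrier_subgroup: "subgroup (carrier (level (loop X) n)) (level X (Suc n))"
proof -
  interpret K: group "level X (Suc n)" by (rule group_level)
  have "group_hom (level X (Suc n)) (level X n) (face X (Suc n) 0)"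
    using face_hom [of 0 n] group_level by (simp add: group_hom_def group_hom_axioms_def)
  then show ?thesis
    using K.subgroups_Inter_pair [OF group_hom.subgroup_kernel R0_subgroup [OF simplicial_group_axioms]]
    by (simp add: loop_def)
qed

lemma face_loop_closed:
  assumes "j \<le> Suc n" "x \<in> carrier (level (loop X) (Suc n))"
  shows "face X (Suc (Suc n)) (Suc j) x \<in> carrier (level (loop X) n)"
proof -
  have x: "x \<in> carrier (level X (Suc (Suc n)))" "x \<in> R0 X (Suc (Suc n))"
    "face X (Suc (Suc n)) 0 x = \<one>\<^bsub>level X (Suc n)\<^esub>"
    using assms(2) by (simp_all add: mem_carrier_loop)
  have "face X (Suc n) 0 (face X (Suc (Suc n)) (Suc j) x) = \<one>\<^bsub>level X n\<^esub>"
    using face_face [of 0 "Suc j" n x] x assms(1) face_one by simp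
  then show ?thesis
    using x assms(1) face_closed R0_Suc [OF simplicial_group_axioms, of x "Suc n"]
    by (simp add: mem_carrier_loop)
qed

lemma degen_loop_closed:
  assumes "j \<le> n" "x \<in> carrier (level (loop X) n)"
  shows "degen X (Suc n) (Suc j) x \<in> carrier (level (loop X) (Suc n))"
proof -
  have x: "x \<in> carrier (level X (Suc n))" "x \<in> R0 X (Suc n)"
    "face X (Suc n) 0 x = \<one>\<^bsub>level X n\<^esub>"
    using assms(2) by (simp_all add: mem_carrier_loop)
  have "face X (Suc (Suc n)) 0 (degen X (Suc n) (Suc j) x) = \<one>\<^bsub>level X (Suc n)\<^esub>"
    using face_degen_less [of 0 "Suc j" "Suc n" x] x assms(1) degen_one by simp
  then show ?thesis
    using x assms(1) degen_closed degen_R0 by (simp add: mem_carrier_loop)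
qed

lemma simplicial_group_loop: "simplicial_group (loop X)"
proof (rule simplicial_group.intro)
  fix n
  show "group (level (loop X) n)"
    using subgroup.subgroup_is_group [OF loop_carrier_subgroup group_level]
    by (simp flip: level_loop)
next
  fix j n :: nat assume j: "j \<le> Suc n"
  show "face (loop X) (Suc n) j \<in> hom (level (loop X) (Suc n)) (level (loop X) n)"
    using j face_loop_closed hom_mult [OF face_hom [of "Suc j" "Suc n"]]
    by (auto intro!: homI simp: loop_carrierD)
next
  fix j n :: nat assume j: "j \<le> n"
  show "degen (loop X) n j \<in> hom (level (loop X) n) (level (loop X) (Suc n))"
    using j degen_loop_closed hom_mult [OF degen_hom [of "Suc j" "Suc n"]]
    by (auto intro!: homI simp: loop_carrierD)
next
  fix i j n x assume "i < j" "j \<le> Suc (Suc n)" "x \<in> carrier (level (loop X) (Suc (Suc n)))"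
  then show "face (loop X) (Suc n) i (face (loop X) (Suc (Suc n)) j x)
      = face (loop X) (Suc n) (j - 1) (face (loop X) (Suc (Suc n)) i x)"
    using face_face [of "Suc i" "Suc j" "Suc n" x] by (auto dest: loop_carrierD)
next
  fix i j n x assume "i \<le> j" "j \<le> n" "x \<in> carrier (level (loop X) n)"
  then show "degen (loop X) (Suc n) i (degen (loop X) n j x)
      = degen (loop X) (Suc n) (j + 1) (degen (loop X) n i x)"
    using degen_degen [of "Suc i" "Suc j" "Suc n" x] by (auto dest: loop_carrierD)
next
  fix i j n x assume "i < j" "j \<le> n" "x \<in> carrier (level (loop X) n)"
  then show "face (loop X) (Suc n) i (degen (loop X) n j x)
      = degen (loop X) (n - 1) (j - 1) (face (loop X) n i x)"
    using face_degen_less [of "Suc i" "Suc j" "Suc n" x] by (auto dest: loop_carrierD)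
next
  fix i j n x assume "i = j \<or> i = j + 1" "j \<le> n" "x \<in> carrier (level (loop X) n)"
  then show "face (loop X) (Suc n) i (degen (loop X) n j x) = x"
    using face_degen_id [of "Suc i" "Suc j" "Suc n" x] by (auto dest: loop_carrierD)
next
  fix i j n x assume "j + 1 < i" "i \<le> Suc n" "x \<in> carrier (level (loop X) n)"
  then show "face (loop X) (Suc n) i (degen (loop X) n j x)
      = degen (loop X) (n - 1) j (face (loop X) n (i - 1) x)"
    using face_degen_greater [of "Suc j" "Suc i" "Suc n" x] by (auto dest: loop_carrierD)
qed

end

section \<open>The braiding of the loop simplicial group\<close>

context braiding
begin

lemma braid_gen_sigma_in_carrier:
  "- 1 \<le> k \<Longrightarrow> k \<le> int n - 2 \<Longrightarrow> braid_gen (n + 1) (nat (k + 2)) \<in> carrier (braid_group (n + 1))"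
  by (rule braid_gen_in_carrier) auto

lemma sigma_closed:
  "- 1 \<le> k \<Longrightarrow> k \<le> int n - 2 \<Longrightarrow> x \<in> carrier (level X n) \<Longrightarrow>
    braid_sigma \<phi> n k x \<in> carrier (level X n)"
  unfolding braid_sigma_def
  using action_bij [OF action braid_gen_sigma_in_carrier] by (meson bij_betwE)

lemma sigma_eq_one_iff:
  assumes "- 1 \<le> k" "k \<le> int n - 2" "x \<in> carrier (level X n)"
  shows "braid_sigma \<phi> n k x = \<one>\<^bsub>level X n\<^esub> \<longleftrightarrow> x = \<one>\<^bsub>level X n\<^esub>"
proof -
  have g: "braid_gen (n + 1) (nat (k + 2)) \<in> carrier (braid_group (n + 1))"
    using assms by (simp only: braid_gen_sigma_in_carrier)
  have "braid_sigma \<phi> n k \<one>\<^bsub>level X n\<^esub> = \<one>\<^bsub>level X n\<^esub>"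
    unfolding braid_sigma_def
    using action_in_hom [OF action g] group_level hom_one by metis
  moreover have "inj_on (braid_sigma \<phi> n k) (carrier (level X n))"
    unfolding braid_sigma_def using action_bij [OF action g] by (rule bij_betw_imp_inj_on)
  moreover have "\<one>\<^bsub>level X n\<^esub> \<in> carrier (level X n)"
    using group_level by (simp add: group.is_monoid monoid.one_closed)
  ultimately show ?thesis
    using assms(3) by (metis inj_onD)
qed

text \<open>
  An element lies in \<open>R\<^sub>0\<close> iff all its faces do. The faces of \<open>\<sigma>\<^sub>k x\<close> are those of \<open>x\<close>, permuted and moved
  by generators of lower degree, and these do not affect membership by induction.
\<close>

lemma sigma_mem_R0_iff:
  "- 1 \<le> k \<Longrightarrow> k \<le> int q - 2 \<Longrightarrow> x \<in> carrier (level X q) \<Longrightarrow>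
    braid_sigma \<phi> q k x \<in> R0 X q \<longleftrightarrow> x \<in> R0 X q"
proof (induction q arbitrary: k x)
  case 0
  then show ?case by simp
next
  case (Suc q)
  \<comment> \<open>On the \<open>q + 2\<close> faces the generator acts by the transposition of \<open>k + 1\<close> and \<open>k + 2\<close>.\<close>
  define \<tau> where "\<tau> j = (if int j = k + 1 then j + 1 else if int j = k + 2 then j - 1 else j)" for j
  have \<tau>_le: "\<tau> j \<le> Suc q" if "j \<le> Suc q" for j
    using that Suc.prems(2) by (auto simp: \<tau>_def)
  have \<tau>_\<tau>: "\<tau> (\<tau> j) = j" for j
    using Suc.prems(1) by (auto simp: \<tau>_def)
  have face: "face X (Suc q) j (braid_sigma \<phi> (Suc q) k x) \<in> R0 X q
      \<longleftrightarrow> face X (Suc q) (\<tau> j) x \<in> R0 X q" if j: "j \<le> Suc q" for j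
  proof -
    consider "int j \<le> k" | "int j = k + 1" | "int j = k + 2" | "int j > k + 2" by linarith
    then show ?thesis
    proof cases
      case 1
      then show ?thesis
        using face_sigma_le [OF Suc.prems(1,2) j 1 Suc.prems(3)] Suc.prems
          Suc.IH [of "k - 1" "face X (Suc q) j x"] face_closed [OF j Suc.prems(3)]
        by (simp add: \<tau>_def)
    next
      case 2
      then have "nat (k + 1) = j" "nat (k + 2) = \<tau> j" by (auto simp: \<tau>_def)
      then show ?thesis
        using face_sigma_1 [OF Suc.prems] by simp
    next
      case 3
      then have "nat (k + 2) = j" "nat (k + 1) = \<tau> j" by (auto simp: \<tau>_def)
      then show ?thesis
        using face_sigma_2 [OF Suc.prems] by simp
    next
      case 4
      then show ?thesis
        using face_sigma_greater [OF Suc.prems(1,2) j 4 Suc.prems(3)] Suc.prems j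
          Suc.IH [of k "face X (Suc q) j x"] face_closed [OF j Suc.prems(3)]
        by (simp add: \<tau>_def)
    qed
  qed
  have "(\<forall>j\<le>Suc q. face X (Suc q) (\<tau> j) x \<in> R0 X q) \<longleftrightarrow>
      (\<forall>j\<le>Suc q. face X (Suc q) j x \<in> R0 X q)"
    using \<tau>_le \<tau>_\<tau> by metis
  then show ?case
    using Suc.prems sigma_closed face
    by (simp add: R0_Suc [OF simplicial_group_axioms])
qed

text \<open>The restriction is needed because automorphisms are by definition extensional on the carrier.\<close>

definition loop_action :: "nat \<Rightarrow> braid_word set \<Rightarrow> 'a \<Rightarrow> 'a" where
  "loop_action n b = restrict (\<phi> (Suc n) (braid_shift (Suc n) b)) (carrier (level (loop X) n))"

lemma shifted_action:
  "\<phi> (Suc n) \<circ> braid_shift (Suc n) \<in> hom (braid_group (Suc n)) (AutoGroup (level X (Suc n)))"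
  using hom_compose [OF braid_shift_hom] action [of "Suc n"] by simp

text \<open>Generator number \<open>i\<close> has label \<open>i - 2\<close>, and the shift raises labels by one.\<close>

lemma shifted_action_gen:
  "i \<in> {1..<Suc n} \<Longrightarrow>
    \<phi> (Suc n) (braid_shift (Suc n) (braid_gen (Suc n) i)) = braid_sigma \<phi> (Suc n) (int i - 1)"
  by (simp add: braid_shift_gen braid_sigma_def nat_add_distrib)

lemma sigma_mem_loop_iff:
  assumes "0 \<le> k" "k \<le> int n - 1" "x \<in> carrier (level X (Suc n))"
  shows "braid_sigma \<phi> (Suc n) k x \<in> carrier (level (loop X) n) \<longleftrightarrow> x \<in> carrier (level (loop X) n)"
proof -
  \<comment> \<open>The generator \<open>\<sigma>\<^sub>k\<close> of \<open>G\<^sub>n\<^sub>+\<^sub>1\<close> passes the face \<open>d\<^sub>0\<close> because \<open>k \<ge> 0\<close>.\<close>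
  have "face X (Suc n) 0 (braid_sigma \<phi> (Suc n) k x) = \<one>\<^bsub>level X n\<^esub>
      \<longleftrightarrow> face X (Suc n) 0 x = \<one>\<^bsub>level X n\<^esub>"
    using face_sigma_le [of k "Suc n" 0 x] assms face_closed [of 0 n x]
      sigma_eq_one_iff [of "k - 1" n "face X (Suc n) 0 x"] by simp
  then show ?thesis
    using assms sigma_closed sigma_mem_R0_iff by (simp add: mem_carrier_loop)
qed

lemma shifted_action_stable:
  assumes "b \<in> carrier (braid_group (Suc n))" "x \<in> carrier (level X (Suc n))"
  shows "\<phi> (Suc n) (braid_shift (Suc n) b) x \<in> carrier (level (loop X) n)
    \<longleftrightarrow> x \<in> carrier (level (loop X) n)"
proof -
  let ?S = "{b \<in> carrier (braid_group (Suc n)). \<forall>x\<in>carrier (level X (Suc n)).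
    (\<phi> (Suc n) \<circ> braid_shift (Suc n)) b x \<in> carrier (level (loop X) n)
      \<longleftrightarrow> x \<in> carrier (level (loop X) n)}"
  have "carrier (braid_group (Suc n)) \<subseteq> ?S"
  proof (rule braid_group_generated)
    show "subgroup ?S (braid_group (Suc n))"
      by (rule stabilizer_subgroup [OF group_braid_group shifted_action])
    show "braid_gen (Suc n) i \<in> ?S" if "i \<in> {1..<Suc n}" for i
      using that by (simp add: braid_gen_in_carrier shifted_action_gen sigma_mem_loop_iff
          del: atLeastLessThan_iff) (simp add: sigma_mem_loop_iff)
  qed
  then show ?thesis using assms by auto
qed

lemma loop_action_hom:
  "loop_action n \<in> hom (braid_group (Suc n)) (AutoGroup (level (loop X) n))"
  using restrict_action [OF group_braid_group shifted_action
      subgroup.subset [OF loop_carrier_subgroup] subgroup.m_closed [OF loop_carrier_subgroup]]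
    shifted_action_stable
  by (subst level_loop) (simp add: loop_action_def [abs_def])

lemma sigma_loop:
  assumes "- 1 \<le> k" "k \<le> int n - 2" "x \<in> carrier (level (loop X) n)"
  shows "braid_sigma loop_action n k x = braid_sigma \<phi> (Suc n) (k + 1) x"
proof -
  have "nat (k + 2) \<in> {1..<Suc n}" using assms by auto
  from shifted_action_gen [OF this]
  have "\<phi> (Suc n) (braid_shift (Suc n) (braid_gen (Suc n) (nat (k + 2))))
      = braid_sigma \<phi> (Suc n) (k + 1)"
    using assms(1) by (simp add: add.commute)
  then show ?thesis
    using assms by (simp add: braid_sigma_def [of loop_action] loop_action_def)
qed

lemma sigma_loop_closed:
  assumes "- 1 \<le> k" "k \<le> int n - 2" "x \<in> carrier (level (loop X) n)"
  shows "braid_sigma \<phi> (Suc n) (k + 1) x \<in> carrier (level (loop X) n)"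
  using assms sigma_mem_loop_iff [of "k + 1" n x] by (simp add: loop_carrierD)

lemma braiding_loop: "braiding (loop X) loop_action"
proof (intro braiding.intro braiding_axioms.intro)
  show "simplicial_group (loop X)" by (rule simplicial_group_loop)
  show "loop_action n \<in> hom (braid_group (n + 1)) (AutoGroup (level (loop X) n))" for n
    using loop_action_hom by simp
next
  fix k :: int and n j :: nat and x
  assume k: "- 1 \<le> k" "k \<le> int n - 2" and j: "j \<le> n" "int j \<le> k"
    and x: "x \<in> carrier (level (loop X) n)"
  obtain m where m: "n = Suc m" using k by (cases n) auto
  show "face (loop X) n j (braid_sigma loop_action n k x)
      = braid_sigma loop_action (n - 1) (k - 1) (face (loop X) n j x)"
    using face_sigma_le [of "k + 1" "Suc n" "Suc j" x] k j x face_loop_closed [of j m x]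
      sigma_loop [OF k x] sigma_loop [of "k - 1" m "face X (Suc n) (Suc j) x"]
    by (simp add: m loop_carrierD)
next
  fix k :: int and n :: nat and x
  assume k: "- 1 \<le> k" "k \<le> int n - 2" and x: "x \<in> carrier (level (loop X) n)"
  have index: "Suc (nat (k + 1)) = nat (k + 2)" "Suc (nat (k + 2)) = nat (k + 3)"
    "k + 1 + 1 = k + 2" "k + 1 + 2 = k + 3"
    using k by auto
  show "face (loop X) n (nat (k + 1)) (braid_sigma loop_action n k x)
      = face (loop X) n (nat (k + 2)) x"
    using face_sigma_1 [of "k + 1" "Suc n" x, unfolded index] k x
    by (simp add: sigma_loop loop_carrierD index)
  show "face (loop X) n (nat (k + 2)) (braid_sigma loop_action n k x)
      = face (loop X) n (nat (k + 1)) x"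
    using face_sigma_2 [of "k + 1" "Suc n" x, unfolded index] k x
    by (simp add: sigma_loop loop_carrierD index)
  have s: "degen X (Suc n) (Suc (nat (k + i))) x \<in> carrier (level (loop X) (n + 1))"
    if "i = 1 \<or> i = 2" for i
    using degen_loop_closed [of "nat (k + i)" n x] that k x by auto
  show "degen (loop X) n (nat (k + 1)) (braid_sigma loop_action n k x)
      = braid_sigma loop_action (n + 1) (k + 1)
          (braid_sigma loop_action (n + 1) k (degen (loop X) n (nat (k + 2)) x))"
    using degen_sigma_1 [of "k + 1" "Suc n" x, unfolded index] k x s [of 2]
      sigma_loop_closed [of k "n + 1", OF _ _ s [of 2]]
    by (simp add: sigma_loop loop_carrierD index)
  show "degen (loop X) n (nat (k + 2)) (braid_sigma loop_action n k x)
      = braid_sigma loop_action (n + 1) k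
          (braid_sigma loop_action (n + 1) (k + 1) (degen (loop X) n (nat (k + 1)) x))"
    using degen_sigma_2 [of "k + 1" "Suc n" x, unfolded index] k x s [of 1]
      sigma_loop_closed [of "k + 1" "n + 1", OF _ _ s [of 1]]
    by (simp add: sigma_loop loop_carrierD index)
next
  fix k :: int and n j :: nat and x
  assume k: "- 1 \<le> k" "k \<le> int n - 2" and j: "j \<le> n" "int j > k + 2"
    and x: "x \<in> carrier (level (loop X) n)"
  obtain m where m: "n = Suc m" using k by (cases n) auto
  show "face (loop X) n j (braid_sigma loop_action n k x)
      = braid_sigma loop_action (n - 1) k (face (loop X) n j x)"
    using face_sigma_greater [of "k + 1" "Suc n" "Suc j" x] k j x face_loop_closed [of j m x]
      sigma_loop [OF k x] sigma_loop [of k m "face X (Suc n) (Suc j) x"]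
    by (simp add: m loop_carrierD)
next
  fix k :: int and n j :: nat and x
  assume k: "- 1 \<le> k" "k \<le> int n - 2" and j: "j \<le> n" "int j \<le> k"
    and x: "x \<in> carrier (level (loop X) n)"
  show "degen (loop X) n j (braid_sigma loop_action n k x)
      = braid_sigma loop_action (n + 1) (k + 1) (degen (loop X) n j x)"
    using degen_sigma_le [of "k + 1" "Suc n" "Suc j" x] k j x degen_loop_closed [of j n x]
    by (simp add: sigma_loop loop_carrierD)
next
  fix k :: int and n j :: nat and x
  assume k: "- 1 \<le> k" "k \<le> int n - 2" and j: "j \<le> n" "int j > k + 2"
    and x: "x \<in> carrier (level (loop X) n)"
  show "degen (loop X) n j (braid_sigma loop_action n k x)
      = braid_sigma loop_action (n + 1) k (degen (loop X) n j x)"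
    using degen_sigma_greater [of "k + 1" "Suc n" "Suc j" x] k j x degen_loop_closed [of j n x]
    by (simp add: sigma_loop loop_carrierD)
qed

end

lemma braided_loop: "braided_simplicial_group X \<Longrightarrow> braided_simplicial_group (loop X)"
  unfolding braided_simplicial_group_def using braiding.braiding_loop by blast

theorem theorem2p6:
  fixes G :: "'a simplicial_data"
  assumes "braided_simplicial_group G"
  shows "braided_simplicial_group (loop G) \<and>
    (\<forall>m. braided_simplicial_group ((loop ^^ m) G))"
proof (intro conjI allI)
  show "braided_simplicial_group (loop G)"
    using assms by (rule braided_loop)
  show "braided_simplicial_group ((loop ^^ m) G)" for m
    by (induction m) (simp_all add: assms braided_loop)
qed

end
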